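(* Let $e$ be an even positive integer, $q=2^e$, $d=(q^2+q+1)/3$, $\sigma(X)=X+X^d+X^{dq}$ (a permutation polynomial of $\mathbb{F}_{q^2}$), and for $\alpha\in\mathbb{F}_q^*$ let $f_\alpha(x)=\operatorname{Tr}_{q^2}(\alpha(\sigma^{-1}(x))^3)$. Let $u$ be a generator of the cyclic group $\mu_{q+1}$ and define $g_\alpha:\mathbb{F}_{q^2}\to\mathbb{F}_2$ by $g_\alpha(0)=0$ and $$g_\alpha(x)=\operatorname{Tr}_{q^2}\!\left(\alpha\,\frac{u^{6i}}{(1+u^{2i}+u^{-2i})^3}x^3\right)\quad\text{for }x\in u^i\mathbb{F}_q^*,\ 0\le i\le q.$$ Then for every $z\in\mu_{q+1}$ and every $x\in z\mathbb{F}_q^*$ one has $\sigma^{-1}(x)=\frac{z^2}{1+z^2+z^{-2}}x$. In particular, $g_\alpha(x)=f_\alpha(x)$ for all $x\in\mathbb{F}_{q^2}$.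
   Context: $\mu_{q+1}=\{z\in\mathbb{F}_{q^2}^*:z^{q+1}=1\}$; $\operatorname{Tr}_{q^2}$ is the absolute trace from $\mathbb{F}_{q^2}$ to $\mathbb{F}_2$; every $x\in\mathbb{F}_{q^2}^*$ lies in exactly one coset $u^i\mathbb{F}_q^*$ with $0\le i\le q$. *)

theory Defs
  imports "HOL-Computational_Algebra.Polynomial"
begin

text \<open>
  Throughout, the type \<open>'a\<close> plays the role of the finite field with \<open>q\<^sup>2\<close> elements
  (the cardinality is a hypothesis of the theorem), where \<open>q = 2 ^ e\<close>. All its subsets and
  subfields are taken inside \<open>'a\<close>; in particular the field with two elements is the prime
  subfield \<open>{0, 1}\<close>.
\<close>

text \<open>The nonzero elements of the subfield with \<open>q\<close> elements, i.e. of the field fixed by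
  \<open>x \<mapsto> x ^ q\<close>.\<close>

definition Fq_star :: "nat \<Rightarrow> 'a::field set" where
  "Fq_star q = {x. x \<noteq> 0 \<and> x ^ q = x}"

definition mu :: "nat \<Rightarrow> 'a::field set" where
  "mu n = {z. z \<noteq> 0 \<and> z ^ n = 1}"

definition Fq_coset :: "nat \<Rightarrow> 'a::field \<Rightarrow> 'a set" where
  "Fq_coset q z = (\<lambda>y. z * y) ` Fq_star q"

text \<open>Absolute trace from the field with \<open>2 ^ n\<close> elements to its prime subfield \<open>{0, 1}\<close>.\<close>

definition abs_trace :: "nat \<Rightarrow> 'a::field \<Rightarrow> 'a" where
  "abs_trace n x = (\<Sum>i<n. x ^ (2 ^ i))"

definition permutation_poly :: "'a::field poly \<Rightarrow> bool" where
  "permutation_poly p \<longleftrightarrow> bij (poly p)"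

text \<open>The division is exact when \<open>q = 2 ^ e\<close> with \<open>e\<close> even, since then \<open>q mod 3 = 1\<close>.\<close>

definition dexp :: "nat \<Rightarrow> nat" where
  "dexp q = (q ^ 2 + q + 1) div 3"

definition sigma :: "nat \<Rightarrow> 'a::field poly" where
  "sigma q = monom 1 1 + monom 1 (dexp q) + monom 1 (dexp q * q)"

definition f_fun :: "nat \<Rightarrow> 'a::field \<Rightarrow> 'a \<Rightarrow> 'a" where
  "f_fun e \<alpha> x = abs_trace (2 * e) (\<alpha> * (inv (poly (sigma (2 ^ e))) x) ^ 3)"

text \<open>The index \<open>i\<close> of the coset containing a nonzero \<open>x\<close> is unique when \<open>u\<close> generates
  \<open>mu (q + 1)\<close>.\<close>

definition coset_index :: "nat \<Rightarrow> 'a::field \<Rightarrow> 'a \<Rightarrow> nat" where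
  "coset_index q u x = (THE i. i \<le> q \<and> x \<in> Fq_coset q (u ^ i))"

definition g_fun :: "nat \<Rightarrow> 'a::field \<Rightarrow> 'a \<Rightarrow> 'a \<Rightarrow> 'a" where
  "g_fun e u \<alpha> x =
    (if x = 0 then 0
     else let i = coset_index (2 ^ e) u x in
       abs_trace (2 * e)
         (\<alpha> * (u ^ (6 * i) / (1 + u ^ (2 * i) + u powi (- 2 * int i)) ^ 3) * x ^ 3))"

end

theory Submission
  imports Defs "HOL-Computational_Algebra.Primes"
begin

text \<open>
  Write \<open>q = 3 m + 1\<close>. Then \<open>d = (q - 1) (m + 1) + 1\<close> and \<open>3 d = q (q + 1) + 1\<close>, so \<open>x \<mapsto> x\<^sup>d\<close> is
  the identity on \<open>\<bbbF>\<^sub>q\<^sup>*\<close> and inverts cubing on \<open>\<mu>\<^bsub>q+1\<^esub>\<close>. Hence, for \<open>z \<in> \<mu>\<^bsub>q+1\<^esub>\<close> and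
  \<open>y \<in> \<bbbF>\<^sub>q\<^sup>*\<close>, \<open>\<sigma> (z\<^sup>3 y) = (z\<^sup>3 + z + 1/z) y = z (1 + z\<^sup>2 + 1/z\<^sup>2) y\<close>. The middle factor is a nonzero
  element of \<open>\<bbbF>\<^sub>q\<close>, so every element of the coset \<open>z \<bbbF>\<^sub>q\<^sup>*\<close> has an explicit preimage.
\<close>

section \<open>Finite fields, roots of unity, and powers of two modulo 3\<close>

lemma finite_field_power_card_minus_1:
  fixes x :: "'a::{field,finite}"
  assumes "x \<noteq> 0"
  shows "x ^ (card (UNIV :: 'a set) - 1) = 1"
proof -
  \<comment> \<open>Multiplication by \<open>x\<close> permutes the nonzero elements, so their
    product is unchanged by the extra factor \<open>x ^ card (- {0})\<close>.\<close>
  have "bij_betw ((*) x) (- {0}) (- {0})"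
    by (rule bij_betw_byWitness[where f' = "\<lambda>y. y / x"]) (use assms in auto)
  then have "\<Prod>(- {0}) = (\<Prod>y\<in>- {0}. x * y)"
    using prod.reindex_bij_betw[of "(*) x" "- {0}" "- {0}" "\<lambda>y. y"] by simp
  also have "\<dots> = x ^ card (- {0 :: 'a}) * \<Prod>(- {0})"
    by (simp add: prod.distrib)
  finally show ?thesis
    by (simp add: Compl_eq_Diff_UNIV card_Diff_singleton)
qed

text \<open>The number of nonzero elements is odd, so raising \<open>- 1\<close> to it yields both
  \<open>- 1\<close> and \<open>1\<close>; hence 2 = 0.\<close>

lemma finite_field_even_card_CHAR:
  assumes "even (card (UNIV :: 'a::{field,finite} set))"
  shows "CHAR('a) = 2"
proof -
  have "odd (card (UNIV :: 'a set) - 1)"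
    using assms finite_UNIV_card_ge_0[where ?'a = 'a] by auto
  with finite_field_power_card_minus_1[of "- 1 :: 'a"] have "- 1 = (1 :: 'a)"
    by simp
  then have "of_nat 2 = (0 :: 'a)"
    by (metis add.left_inverse of_nat_1 of_nat_add one_add_one)
  then have "CHAR('a) dvd 2"
    by (simp only: of_nat_eq_0_iff_char_dvd)
  then show ?thesis
    using CHAR_not_1[where ?'a = 'a] two_is_prime_nat by (auto simp: prime_nat_iff)
qed

lemma card_roots_of_unity_le:
  fixes n :: nat
  assumes "n > 0"
  shows "card {x :: 'a::idom. x ^ n = 1} \<le> n"
proof -
  let ?p = "monom (1 :: 'a) n - 1"
  have "coeff ?p n = 1"
    using assms by simp
  then have "?p \<noteq> 0"
    by (metis coeff_0 zero_neq_one)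
  from card_poly_roots_bound[OF this] have "card {x :: 'a. x ^ n = 1} \<le> degree ?p"
    by (simp add: poly_monom)
  also have "\<dots> \<le> n"
    by (intro degree_diff_le degree_monom_le) auto
  finally show ?thesis .
qed

text \<open>For even \<open>e\<close> this is a power of 4, and 4 is congruent to 1 modulo
  3.\<close>

lemma mod_3_two_power_even:
  assumes "even e"
  obtains m where "(2 :: nat) ^ e = 3 * m + 1"
proof -
  obtain k where "e = 2 * k"
    using assms by blast
  then have "(2 :: nat) ^ e mod 3 = (4 mod 3) ^ k mod 3"
    by (subst power_mod) (simp add: power_mult)
  then have "(2 :: nat) ^ e = 3 * (2 ^ e div 3) + 1"
    using mult_div_mod_eq[of 3 "(2 :: nat) ^ e"] by simp
  then show ?thesis
    by (rule that)
qed

section \<open>Characteristic 2 arithmetic in the field with \<open>q ^ 2\<close> elements\<close>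

context
  fixes e q :: nat
  assumes e: "e > 0" "even e"
    and q: "q = 2 ^ e"
    and card: "card (UNIV :: 'a::{field,finite} set) = q ^ 2"
begin

private lemma even_q: "even q"
  using e q by simp

private lemma q_ge_2: "q \<ge> 2"
  using e q self_le_power[of 2 e] by simp

private lemma CHAR_2: "CHAR('a) = 2"
  by (rule finite_field_even_card_CHAR) (simp add: card even_q)

private lemma add_self: "x + x = (0 :: 'a)"
  using of_nat_CHAR[where ?'a = 'a] by (simp add: CHAR_2 flip: mult_2)

private lemma power_q_add: "(x + y) ^ q = x ^ q + (y :: 'a) ^ q"
  by (rule freshmans_dream'[where n = e]) (simp_all add: CHAR_2 q)

private lemma power_q2: "x ^ (q ^ 2) = (x :: 'a)"
proof (cases "x = 0")
  case False
  have "x ^ (q ^ 2) = x * x ^ (q ^ 2 - 1)"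
    using q_ge_2 by (metis power_eq_if power_not_zero not_numeral_le_zero zero_eq_power2)
  then show ?thesis
    using finite_field_power_card_minus_1[OF False] by (simp add: card)
qed (use q_ge_2 in simp)

text \<open>Here \<open>- 1 = 1\<close>, so square roots are unique; this is what separates the
  cosets below.\<close>

private lemma square_eq_one:
  assumes "(y :: 'a) ^ 2 = 1"
  shows "y = 1"
proof -
  have "(- 1 :: 'a) = 1"
    using add_self[of 1] by (simp add: eq_neg_iff_add_eq_0)
  then show ?thesis
    using assms by (metis power2_eq_1_iff)
qed

section \<open>Polar decomposition and the size of \<open>mu (q + 1)\<close>\<close>

lemma Fq_coset_exists:
  assumes "x \<noteq> (0 :: 'a)"
  obtains z where "z \<in> mu (q + 1)" "x \<in> Fq_coset q z"
proof -
  \<comment> \<open>Since \<open>x ^ (q ^ 2) = x\<close>, the exponent \<open>q ^ 2 div 2\<close>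
    extracts square roots. Thus \<open>y\<close> is the square root of the norm
    \<open>x ^ (q + 1)\<close>, it lies in the subfield, and \<open>x / y\<close> has norm
    1.\<close>
  define y where "y = x ^ ((q + 1) * (q ^ 2 div 2))"
  have "x ^ ((q + 1) * q) = x ^ (q ^ 2) * x ^ q"
    by (simp add: power2_eq_square algebra_simps flip: power_add)
  also have "\<dots> = x ^ (q + 1)"
    by (simp add: power_q2)
  finally have norm: "x ^ ((q + 1) * q) = x ^ (q + 1)" .
  have "y ^ q = (x ^ ((q + 1) * q)) ^ (q ^ 2 div 2)"
    unfolding y_def power_mult[symmetric] by (simp only: ac_simps)
  also have "\<dots> = y"
    unfolding norm y_def by (rule power_mult[symmetric])
  finally have yq: "y ^ q = y" .
  have "y ^ 2 = (x ^ (q + 1)) ^ (q ^ 2 div 2 * 2)"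
    by (simp only: y_def power_mult)
  also have "q ^ 2 div 2 * 2 = q ^ 2"
    using even_q by simp
  finally have "y ^ 2 = x ^ (q + 1)"
    by (simp only: power_q2)
  then have yq1: "y ^ (q + 1) = x ^ (q + 1)"
    by (simp add: yq power2_eq_square)
  have y0: "y \<noteq> 0"
    using assms by (simp add: y_def)
  show ?thesis
  proof
    show "x / y \<in> mu (q + 1)"
      using assms y0 yq1 by (simp add: mu_def power_divide del: power_Suc)
    show "x \<in> Fq_coset q (x / y)"
      using y0 yq by (auto simp: Fq_coset_def Fq_star_def intro!: image_eqI[of _ _ y])
  qed
qed

text \<open>The norm of \<open>z * y\<close> is \<open>y ^ 2\<close>, so \<open>x\<close> determines
  \<open>y\<close> and therefore \<open>z\<close>.\<close>

lemma Fq_coset_unique: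
  assumes "z \<in> mu (q + 1)" "w \<in> mu (q + 1)" "x \<in> Fq_coset q z" "x \<in> Fq_coset q (w :: 'a)"
  shows "z = w"
proof -
  obtain y where y: "x = z * y" "y \<noteq> 0" "y ^ q = y"
    using assms(3) by (auto simp: Fq_coset_def Fq_star_def)
  obtain y' where y': "x = w * y'" "y' \<noteq> 0" "y' ^ q = y'"
    using assms(4) by (auto simp: Fq_coset_def Fq_star_def)
  have "x ^ (q + 1) = y * y"
    using assms(1) y(3) by (simp add: y(1) mu_def power_mult_distrib ac_simps)
  moreover have "x ^ (q + 1) = y' * y'"
    using assms(2) y'(3) by (simp add: y'(1) mu_def power_mult_distrib ac_simps)
  ultimately have "y * y = y' * y'"
    by simp
  then have "(y / y') ^ 2 = 1"
    using y'(2) by (simp add: power2_eq_square)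
  then have "y = y'"
    using square_eq_one y'(2) by fastforce
  then show ?thesis
    using y y' by simp
qed

text \<open>A count: products from \<open>mu (q + 1)\<close> and \<open>Fq_star q\<close> cover all
  \<open>(q + 1) * (q - 1)\<close> nonzero elements, and the second factor has at most
  \<open>q - 1\<close> members.\<close>

lemma card_mu_ge: "card (mu (q + 1) :: 'a set) \<ge> q + 1"
proof -
  have "- {0} \<subseteq> (\<lambda>(z, y). z * y) ` (mu (q + 1) \<times> (Fq_star q :: 'a set))"
  proof
    fix x :: 'a
    assume "x \<in> - {0}"
    then obtain z where "z \<in> mu (q + 1)" "x \<in> Fq_coset q z"
      using Fq_coset_exists by blast
    then show "x \<in> (\<lambda>(z, y). z * y) ` (mu (q + 1) \<times> Fq_star q)"
      by (auto simp: Fq_coset_def)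
  qed
  then have "card (- {0 :: 'a}) \<le> card (mu (q + 1) \<times> Fq_star q :: ('a \<times> 'a) set)"
    by (rule surj_card_le[rotated]) simp
  then have "q ^ 2 - 1 \<le> card (mu (q + 1) :: 'a set) * card (Fq_star q :: 'a set)"
    by (simp add: Compl_eq_Diff_UNIV card_Diff_singleton card card_cartesian_product)
  moreover have "card (Fq_star q :: 'a set) \<le> q - 1"
  proof -
    have "Fq_star q \<subseteq> {x :: 'a. x ^ (q - 1) = 1}"
      using q_ge_2 by (auto simp: Fq_star_def power_eq_if[of _ q])
    then have "card (Fq_star q :: 'a set) \<le> card {x :: 'a. x ^ (q - 1) = 1}"
      by (intro card_mono) auto
    also have "\<dots> \<le> q - 1"
      using q_ge_2 by (intro card_roots_of_unity_le) simp
    finally show ?thesis .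
  qed
  ultimately have "q ^ 2 - 1 \<le> card (mu (q + 1) :: 'a set) * (q - 1)"
    by (meson mult_le_mono2 order_trans)
  moreover have "q ^ 2 - 1 = (q + 1) * (q - 1)"
    by (simp add: power2_eq_square algebra_simps)
  ultimately have "(q + 1) * (q - 1) \<le> card (mu (q + 1) :: 'a set) * (q - 1)"
    by (simp only:)
  then show ?thesis
    using q_ge_2 by (simp only: mult_le_cancel2)
qed

section \<open>Indexing the cosets by powers of the generator\<close>

lemma inj_on_generator_power:
  fixes u :: 'a
  assumes u: "range (\<lambda>k::int. u powi k) = mu (q + 1)"
  shows "inj_on (\<lambda>i. u ^ i) {0..q}" "(\<lambda>i. u ^ i) ` {0..q} = mu (q + 1)"
proof -
  have "u powi 1 \<in> mu (q + 1)"
    using u by blast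
  then have u1: "u ^ (q + 1) = 1" "u \<noteq> 0"
    by (simp_all add: mu_def)
  show img: "(\<lambda>i. u ^ i) ` {0..q} = mu (q + 1)"
  proof (intro equalityI subsetI)
    fix z :: 'a
    assume "z \<in> mu (q + 1)"
    then obtain k :: int where k: "z = u powi k"
      using u by blast
    let ?n = "int (q + 1)"
    \<comment> \<open>The integer exponent is reduced modulo \<open>q + 1\<close>, the remainder
      being an index in \<open>{0..q}\<close>.\<close>
    have "z = u powi (?n * (k div ?n) + k mod ?n)"
      by (simp add: k)
    also have "\<dots> = (u powi ?n) powi (k div ?n) * u powi (k mod ?n)"
      using u1 by (simp only: power_int_add power_int_mult simp_thms)
    also have "u powi ?n = 1"
      using u1 by (simp only: power_int_of_nat)
    also have "k mod ?n = int (nat (k mod ?n))"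
      by simp
    finally have "z = u ^ nat (k mod ?n)"
      by (simp only: power_int_of_nat power_int_1_left mult_1)
    moreover have "nat (k mod ?n) \<le> q"
      using pos_mod_bound[of ?n k] by linarith
    ultimately show "z \<in> (\<lambda>i. u ^ i) ` {0..q}"
      by auto
  next
    fix z
    assume "z \<in> (\<lambda>i. u ^ i) ` {0..q}"
    then obtain i where "z = u powi int i"
      by auto
    then show "z \<in> mu (q + 1)"
      using u by blast
  qed
  \<comment> \<open>The \<open>q + 1\<close> indices have an image with at least
    \<open>q + 1\<close> elements, so no two powers coincide.\<close>
  have "card ((\<lambda>i. u ^ i) ` {0..q}) = card {0..q}"
    using card_mu_ge card_image_le[of "{0..q}" "\<lambda>i. u ^ i"] by (simp add: img)
  then show "inj_on (\<lambda>i. u ^ i) {0..q}"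
    by (simp add: inj_on_iff_eq_card)
qed

text \<open>Justifies the definite description in \<open>coset_index\<close>: polar decomposition
  gives existence, and uniqueness of the coset with injectivity of the powers gives
  uniqueness.\<close>

lemma coset_index_eq:
  fixes u x :: 'a
  assumes u: "range (\<lambda>k::int. u powi k) = mu (q + 1)" and "x \<noteq> 0"
  shows "u ^ coset_index q u x \<in> mu (q + 1)" "x \<in> Fq_coset q (u ^ coset_index q u x)"
proof -
  note power = inj_on_generator_power[OF u]
  obtain z where z: "z \<in> mu (q + 1)" "x \<in> Fq_coset q z"
    using Fq_coset_exists \<open>x \<noteq> 0\<close> .
  then obtain i where i: "i \<le> q" "z = u ^ i"
    unfolding power(2)[symmetric] by auto
  have "coset_index q u x = i"
    unfolding coset_index_def
  proof (rule the_equality)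
    show "i \<le> q \<and> x \<in> Fq_coset q (u ^ i)"
      using i z by simp
    fix j
    assume j: "j \<le> q \<and> x \<in> Fq_coset q (u ^ j)"
    then have "u ^ j \<in> mu (q + 1)"
      unfolding power(2)[symmetric] by simp
    then have "u ^ j = u ^ i"
      using Fq_coset_unique z i j by blast
    then show "j = i"
      using inj_onD[OF power(1)] i j by simp
  qed
  then show "u ^ coset_index q u x \<in> mu (q + 1)" "x \<in> Fq_coset q (u ^ coset_index q u x)"
    using z i by simp_all
qed

section \<open>Values of \<open>sigma\<close> on the cosets\<close>

lemma sigma_denominator_nonzero:
  assumes z: "z \<in> mu (q + 1)"
  shows "1 + z ^ 2 + z powi (- 2) \<noteq> (0 :: 'a)"
proof
  assume D: "1 + z ^ 2 + z powi (- 2) = 0"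
  have z': "z \<noteq> 0" "z ^ (q + 1) = 1"
    using z by (simp_all add: mu_def)
  \<comment> \<open>Up to the factor \<open>z ^ 2\<close>, the denominator is the cofactor of
    \<open>z ^ 2 - 1\<close> in \<open>z ^ 6 - 1\<close>.\<close>
  have "(z ^ 2 - 1) * z ^ 2 * (1 + z ^ 2 + z powi (- 2)) = z ^ 6 - 1"
    using z' by (simp add: power_int_minus field_simps)
  then have z6: "z ^ 6 = 1"
    by (simp add: D)
  \<comment> \<open>As \<open>q\<close> is even and 1 modulo 3, \<open>q + 1\<close> is 5 modulo 6.
    So \<open>z ^ 6 = 1\<close> forces \<open>z ^ 5 = 1\<close> and then
    \<open>z = 1\<close>.\<close>
  obtain m where m: "q = 3 * m + 1"
    using mod_3_two_power_even e q by metis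
  with even_q have "odd m"
    by simp
  then obtain j where "m = 2 * j + 1"
    by (elim oddE)
  then have "z ^ (q + 1) = (z ^ 6) ^ j * z ^ 5"
    by (simp add: m add.commute flip: power_mult power_add)
  then have "z ^ 5 = 1"
    using z6 z' by simp
  then have "z = 1"
    using z6 power_Suc[of z 5] by simp
  \<comment> \<open>At \<open>z = 1\<close> the denominator is 1 + 1 + 1 = 1.\<close>
  then show False
    using D add_self[of 1] by (simp del: one_add_one)
qed

text \<open>The \<open>q\<close>-th power inverts \<open>z\<close>, hence swaps \<open>z ^ 2\<close>
  and \<open>z powi (- 2)\<close>. It follows that division by the denominator preserves the
  subfield.\<close>

lemma sigma_denominator_power_q:
  assumes z: "z \<in> mu (q + 1)"
  shows "(1 + z ^ 2 + z powi (- 2)) ^ q = 1 + z ^ 2 + (z :: 'a) powi (- 2)"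
proof -
  have z': "z \<noteq> 0" "z * z ^ q = 1"
    using z by (simp_all add: mu_def)
  then have zq: "z ^ q = inverse z"
    by (metis inverse_unique)
  have "(z ^ 2) ^ q = (z ^ q) ^ 2" "(z powi (- 2)) ^ q = (z ^ q) powi (- 2)"
    by (simp_all add: power_int_minus power_inverse ac_simps flip: power_mult)
  then show ?thesis
    by (simp add: power_q_add zq power_int_minus power_inverse)
qed

lemma dexp_eq:
  obtains m where "dexp q = (q - 1) * (m + 1) + 1" "3 * dexp q = (q + 1) * q + 1"
proof -
  obtain m where m: "q = 3 * m + 1"
    using mod_3_two_power_even e q by metis
  have "q ^ 2 + q + 1 = 3 * ((q - 1) * (m + 1) + 1)"
    by (simp add: m power2_eq_square algebra_simps)
  then show ?thesis
    by (intro that[of m]) (simp_all add: dexp_def power2_eq_square)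
qed

lemma poly_sigma: "poly (sigma q) x = x + x ^ dexp q + (x ^ dexp q) ^ q"
  by (simp add: sigma_def poly_monom power_mult)

lemma poly_sigma_cube:
  fixes y z :: 'a
  assumes y: "y \<in> Fq_star q" and z: "z \<in> mu (q + 1)"
  shows "poly (sigma q) (z ^ 3 * y) = z * (1 + z ^ 2 + z powi (- 2)) * y"
proof -
  have y': "y \<noteq> 0" "y ^ q = y" and z': "z \<noteq> 0" "z * z ^ q = 1" "z ^ (q + 1) = 1"
    using y z by (simp_all add: Fq_star_def mu_def)
  obtain m where m: "dexp q = (q - 1) * (m + 1) + 1" "3 * dexp q = (q + 1) * q + 1"
    using dexp_eq .
  have "y ^ (q - 1) = 1"
    using y' q_ge_2 by (simp add: power_eq_if[of _ q])
  then have "y ^ dexp q = y"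
    by (simp only: m(1) power_add power_mult power_one power_one_right mult_1)
  moreover have "(z ^ 3) ^ dexp q = z"
    unfolding power_mult[symmetric] m(2)
    by (subst power_add, subst power_mult) (simp only: z'(3) power_one power_one_right mult_1)
  ultimately have "(z ^ 3 * y) ^ dexp q = z * y"
    by (simp add: power_mult_distrib)
  moreover have "z ^ q = inverse z"
    using z' by (metis inverse_unique)
  ultimately have "poly (sigma q) (z ^ 3 * y) = z ^ 3 * y + z * y + inverse z * y"
    by (simp add: poly_sigma power_mult_distrib y')
  also have "\<dots> = z * (1 + z ^ 2 + z powi (- 2)) * y"
    using z' by (simp add: power_int_minus field_simps power2_eq_square power3_eq_cube)
  finally show ?thesis .
qed

lemma poly_sigma_preimage:
  fixes x z :: 'a
  assumes z: "z \<in> mu (q + 1)" and x: "x \<in> Fq_coset q z"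
  shows "poly (sigma q) (z ^ 2 / (1 + z ^ 2 + z powi (- 2)) * x) = x"
proof -
  define D where "D = 1 + z ^ 2 + z powi (- 2)"
  have D: "D \<noteq> 0" "D ^ q = D"
    using sigma_denominator_nonzero[OF z] sigma_denominator_power_q[OF z] by (simp_all add: D_def)
  obtain y where y: "y \<in> Fq_star q" "x = z * y"
    using x by (auto simp: Fq_coset_def)
  \<comment> \<open>Replacing \<open>y\<close> by \<open>y / D\<close> cancels the factor
    \<open>D\<close> in the value of \<open>sigma\<close>; the argument
    \<open>z ^ 3 * (y / D)\<close> is \<open>z ^ 2 / D * x\<close> because
    \<open>x = z * y\<close>.\<close>
  have "y / D \<in> Fq_star q"
    using y D by (simp add: Fq_star_def power_divide)
  from poly_sigma_cube[OF this z] have "poly (sigma q) (z ^ 3 * (y / D)) = x"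
    using D by (simp add: y flip: D_def)
  then show ?thesis
    unfolding D_def[symmetric] by (simp add: y power2_eq_square power3_eq_cube ac_simps)
qed

section \<open>The inverse of \<open>sigma\<close> and the comparison of \<open>g_fun\<close> with
  \<open>f_fun\<close>\<close>

lemma poly_sigma_0: "poly (sigma q) (0 :: 'a) = 0"
proof -
  \<comment> \<open>Positivity matters because \<open>0 ^ 0 = 1\<close>.\<close>
  have "dexp q > 0"
    using dexp_eq by (metis add_gr_0 zero_less_one)
  then show ?thesis
    using q_ge_2 by (simp add: poly_sigma zero_power)
qed

text \<open>The explicit preimages give surjectivity, and finiteness of the field turns it into
  bijectivity.\<close>

lemma bij_poly_sigma: "bij (poly (sigma q :: 'a poly))"
proof -
  have "\<exists>w. poly (sigma q) w = x" for x :: 'a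
    using poly_sigma_0 Fq_coset_exists[of x] poly_sigma_preimage by metis
  then have "surj (poly (sigma q :: 'a poly))"
    by (metis surjI)
  then show ?thesis
    by (simp add: bij_def finite_UNIV_surj_inj)
qed

lemma inv_poly_sigma:
  fixes x z :: 'a
  assumes "z \<in> mu (q + 1)" "x \<in> Fq_coset q z"
  shows "inv (poly (sigma q :: 'a poly)) x = z ^ 2 / (1 + z ^ 2 + z powi (- 2)) * x"
  using bij_poly_sigma poly_sigma_preimage[OF assms] by (metis bij_inv_eq_iff)

text \<open>Cubing the inverse formula at \<open>z = u ^ i\<close> produces the trace argument of
  \<open>g_fun\<close>. The point 0 lies in no coset and is treated separately, using that
  \<open>sigma\<close> fixes 0.\<close>

lemma g_fun_eq_f_fun:
  fixes u \<alpha> x :: 'a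
  assumes u: "range (\<lambda>k::int. u powi k) = mu (q + 1)"
  shows "g_fun e u \<alpha> x = f_fun e \<alpha> x"
proof (cases "x = 0")
  case True
  have "inv (poly (sigma q)) (0 :: 'a) = 0"
    using bij_poly_sigma poly_sigma_0 by (metis bij_inv_eq_iff)
  with True show ?thesis
    by (simp add: g_fun_def f_fun_def abs_trace_def zero_power flip: q)
next
  case False
  define i where "i = coset_index q u x"
  have "inv (poly (sigma q)) x
      = (u ^ i) ^ 2 / (1 + (u ^ i) ^ 2 + (u ^ i) powi (- 2)) * x"
    using inv_poly_sigma coset_index_eq[OF u False] by (simp add: i_def)
  also have "(u ^ i) powi (- 2) = u powi (- 2 * int i)"
    by (metis mult.commute power_int_mult power_int_of_nat)
  finally have "inv (poly (sigma q)) x ^ 3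
      = u ^ (6 * i) / (1 + u ^ (2 * i) + u powi (- 2 * int i)) ^ 3 * x ^ 3"
    by (simp add: power_mult_distrib power_divide mult.commute flip: power_mult)
  with False show ?thesis
    by (simp add: g_fun_def f_fun_def Let_def i_def mult.assoc flip: q)
qed

end

theorem theorem5p2:
  fixes e q :: nat and u \<alpha> :: "'a::{field,finite}"
  assumes e: "e > 0" "even e"
    and q: "q = 2 ^ e"
    and card: "card (UNIV :: 'a set) = q ^ 2"
    and alpha: "\<alpha> \<in> Fq_star q"
    and u: "range (\<lambda>k::int. u powi k) = mu (q + 1)"
  shows "permutation_poly (sigma q :: 'a poly) \<and>
    (\<forall>z \<in> mu (q + 1). \<forall>x \<in> Fq_coset q z.
       inv (poly (sigma q :: 'a poly)) x = z ^ 2 / (1 + z ^ 2 + z powi (- 2)) * x) \<and>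
    (\<forall>x. g_fun e u \<alpha> x = f_fun e \<alpha> x)"
  unfolding permutation_poly_def
  using bij_poly_sigma[OF e q card] inv_poly_sigma[OF e q card] g_fun_eq_f_fun[OF e q card u]
  by blast

end
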